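(* Let $M\in[0,1]^{m\times n}$, $\rho\in[0,1)$, $t>0$, and $\delta\in(0,1)$. Let $Y\in\{0,1\}^{m\times n}$ have independent entries with $P(Y_{ij}=1)=M_{ij}$, let $s$ denote the number of ones in $Y$, and let $A\in\{0,1\}^{m\times n}$ be the observation matrix with independent entries satisfying $P(A_{ij}=1)=M_{ij}(1-\rho)$, $P(A_{ij}=0)=1-M_{ij}(1-\rho)$, obtained by revealing each 1 of $Y$ independently with probability $1-\rho$ (0's of $Y$ always give $A_{ij}=0$). Define $$\tilde{\ell}(x,a)=\begin{cases}\dfrac{(x-1)^2-\rho x^2}{1-\rho} & \text{if } a=1,\\[1mm] x^2 & \text{if } a=0,\end{cases}$$ the empirical error $\hat{R}_{\tilde{\ell}}(X)=\frac{1}{mn}\sum_{i,j}\tilde{\ell}(X_{ij},A_{ij})$ and the expected error $E_A[R_{\tilde{\ell}}(X)]=E_A\big[\frac{1}{mn}\sum_{i,j}\tilde{\ell}(X_{ij},A_{ij})\big]$. Let $\mathcal{X}=\{X\in\mathbb{R}^{m\times n}:\|X\|_*\le t,\ 0\le X_{ij}\le 1\ \forall (i,j)\}$. Then there is a constant $C$ such that, with probability at least $1-\delta$, $$\max_{X\in\mathcal{X}}\Big|E_A[R_{\tilde{\ell}}(X)]-\hat{R}_{\tilde{\ell}}(X)\Big|\le tC\,\frac{\sqrt{n}+\sqrt{m}+\sqrt[4]{s}}{(1-\rho)mn}+3\,\frac{\sqrt{\log(2/\delta)}}{\sqrt{mn}\,(1-\rho)}.$$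
   Context: $\|X\|_*$ denotes the nuclear (trace) norm. This is the non-deterministic PU matrix completion model: each entry $M_{ij}$ is the probability that the clean binary entry $Y_{ij}$ equals 1, and only a random fraction $1-\rho$ of the ones of $Y$ are observed (recorded as $A_{ij}=1$); all other entries of $A$ are $0$. *)

theory Defs
  imports "HOL-Probability.Probability" "Jordan_Normal_Form.Char_Poly"
begin

text \<open>Nuclear (trace) norm: the sum of the singular values of X, i.e. the sum of
  the square roots of the eigenvalues (counted with algebraic multiplicity) of
  the Gram matrix X^T X.\<close>
definition nuclear_norm :: "real mat \<Rightarrow> real" where
  "nuclear_norm X =
     (let p = char_poly (transpose_mat X * X)
      in \<Sum>e\<in>{e. poly p e = 0}. real (order e p) * sqrt e)"

definition entry_pmf :: "real \<Rightarrow> real \<Rightarrow> (bool \<times> bool) pmf" where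
  "entry_pmf \<rho> p =
     do { y \<leftarrow> bernoulli_pmf p;
          a \<leftarrow> (if y then bernoulli_pmf (1 - \<rho>) else return_pmf False);
          return_pmf (y, a) }"

definition YA_pmf :: "nat \<Rightarrow> nat \<Rightarrow> real mat \<Rightarrow> real \<Rightarrow> (nat \<times> nat \<Rightarrow> bool \<times> bool) pmf" where
  "YA_pmf m n M \<rho> = Pi_pmf ({..<m} \<times> {..<n}) (False, False) (\<lambda>(i, j). entry_pmf \<rho> (M $$ (i, j)))"

definition Y_of :: "(nat \<times> nat \<Rightarrow> bool \<times> bool) \<Rightarrow> nat \<times> nat \<Rightarrow> bool" where
  "Y_of \<omega> = (\<lambda>ij. fst (\<omega> ij))"

definition A_of :: "(nat \<times> nat \<Rightarrow> bool \<times> bool) \<Rightarrow> nat \<times> nat \<Rightarrow> bool" where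
  "A_of \<omega> = (\<lambda>ij. snd (\<omega> ij))"

definition num_ones :: "nat \<Rightarrow> nat \<Rightarrow> (nat \<times> nat \<Rightarrow> bool) \<Rightarrow> nat" where
  "num_ones m n Y = card {(i, j). i < m \<and> j < n \<and> Y (i, j)}"

definition loss_tilde :: "real \<Rightarrow> real \<Rightarrow> bool \<Rightarrow> real" where
  "loss_tilde \<rho> x a = (if a then ((x - 1)\<^sup>2 - \<rho> * x\<^sup>2) / (1 - \<rho>) else x\<^sup>2)"

definition emp_risk :: "real \<Rightarrow> real mat \<Rightarrow> (nat \<times> nat \<Rightarrow> bool) \<Rightarrow> real" where
  "emp_risk \<rho> X A =
     (1 / (real (dim_row X) * real (dim_col X))) *
     (\<Sum>i<dim_row X. \<Sum>j<dim_col X. loss_tilde \<rho> (X $$ (i, j)) (A (i, j)))"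

definition exp_risk :: "nat \<Rightarrow> nat \<Rightarrow> real mat \<Rightarrow> real \<Rightarrow> real mat \<Rightarrow> real" where
  "exp_risk m n M \<rho> X = measure_pmf.expectation (YA_pmf m n M \<rho>) (\<lambda>\<omega>. emp_risk \<rho> X (A_of \<omega>))"

definition feasible_set :: "nat \<Rightarrow> nat \<Rightarrow> real \<Rightarrow> real mat set" where
  "feasible_set m n t = {X \<in> carrier_mat m n. nuclear_norm X \<le> t \<and>
      (\<forall>i<m. \<forall>j<n. 0 \<le> X $$ (i, j) \<and> X $$ (i, j) \<le> 1)}"

end

theory Submission
  imports Defs "Jordan_Normal_Form.Schur_Decomposition"
begin

text \<open>
  The quadratic part of the loss does not depend on the observation, so the deviation is linear
  in \<open>X\<close>: up to the factor \<open>1 / ((1 - \<rho>) m n)\<close> it is the pairing of \<open>1 - 2 X\<close> with the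
  centred noise \<open>W = E A - A\<close>. Since \<open>\<bar>1 - 2 X\<bar> \<le> 1\<close> on the feasible set, changing one entry of the sample
  moves the supremum over \<open>X\<close> by at most 1, and McDiarmid's inequality concentrates the supremum
  around its mean with no dependence on \<open>t\<close>. By duality of nuclear and operator norm the mean is at
  most \<open>E \<bar>\<Sum> W\<bar> + 2 t E \<parallel>W\<parallel>\<close>. Rounding the scaled unit vectors \<open>sqrt m u\<close> and \<open>sqrt n v\<close> coordinatewise to integers
  bounds \<open>\<parallel>W\<parallel>\<close> by a maximum over at most \<open>48 ^ (m + n)\<close> pairs of integer points, and the
  sub-Gaussian moment bound for each pair gives \<open>E \<parallel>W\<parallel> \<le> (ln 48 + 2) sqrt (m + n)\<close>.
\<close>

section \<open>Nuclear norm duality\<close>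

text \<open>Over the complex numbers the characteristic polynomial has a root \<open>k\<close>. The
  Hermitian form of a real symmetric matrix takes real values, which forces \<open>k\<close> to be
  real.\<close>

lemma real_symmetric_eigenvector_exists:
  fixes G :: "real mat"
  assumes G: "G \<in> carrier_mat n n" and sym: "transpose_mat G = G" and n: "n \<noteq> 0"
  obtains e v where "v \<in> carrier_vec n" "v \<noteq> 0\<^sub>v n" "G *\<^sub>v v = e \<cdot>\<^sub>v v"
proof -
  define H where "H = map_mat complex_of_real G"
  have H: "H \<in> carrier_mat n n" using G by (simp add: H_def)
  have "degree (char_poly H) = n" using degree_monic_char_poly[OF H] by simp
  hence "\<not> constant (poly (char_poly H))" using n constant_degree by metis
  then obtain k where k: "poly (char_poly H) k = 0"
    using fundamental_theorem_of_algebra by blast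
  hence "eigenvalue H k" using eigenvalue_root_char_poly[OF H] by simp
  then obtain v where v: "v \<in> carrier_vec n" "v \<noteq> 0\<^sub>v n" "H *\<^sub>v v = k \<cdot>\<^sub>v v"
    using H unfolding eigenvalue_def eigenvector_def by auto
  have Gsym: "G $$ (i, j) = G $$ (j, i)" if "i < n" "j < n" for i j
    using arg_cong[OF sym, of "\<lambda>A. A $$ (i, j)"] G that by auto
  have Hv: "(\<Sum>j<n. complex_of_real (G $$ (i, j)) * v $ j) = k * v $ i" if "i < n" for i
    using arg_cong[OF v(3), of "\<lambda>w. w $ i"] H G v(1) that
    by (auto simp: scalar_prod_def H_def atLeast0LessThan)
  \<comment> \<open>\<open>q\<close> is the Hermitian form of \<open>H\<close> at \<open>v\<close>
    and \<open>r\<close> the squared length of \<open>v\<close>, so \<open>q = k * r\<close>.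
    Conjugation exchanges the two summation indices, and symmetry makes \<open>q\<close> its own
    conjugate.\<close>
  define r where "r = (\<Sum>i<n. (cmod (v $ i))\<^sup>2)"
  define q where "q = (\<Sum>i<n. cnj (v $ i) * (\<Sum>j<n. complex_of_real (G $$ (i, j)) * v $ j))"
  have qk: "q = k * complex_of_real r"
    unfolding q_def r_def
    by (simp add: Hv sum_distrib_left mult.left_commute complex_norm_square mult.commute[of "cnj _"]
        del: of_real_power)
  have "cnj q = (\<Sum>i<n. \<Sum>j<n. v $ i * (complex_of_real (G $$ (i, j)) * cnj (v $ j)))"
    by (simp add: q_def sum_distrib_left)
  also have "\<dots> = (\<Sum>j<n. \<Sum>i<n. v $ i * (complex_of_real (G $$ (i, j)) * cnj (v $ j)))"
    by (rule sum.swap)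
  also have "\<dots> = q"
    unfolding q_def sum_distrib_left
    by (intro sum.cong refl) (use Gsym in \<open>auto simp: mult_ac\<close>)
  finally have q: "Im q = 0"
    by (metis cnj.sel(2) equal_neg_zero)
  obtain i where i: "i < n" "v $ i \<noteq> 0" using v(1,2) by (metis carrier_vecD eq_vecI index_zero_vec)
  have "r > 0" unfolding r_def
    by (rule sum_pos2[of _ i]) (use i in auto)
  hence "Im k = 0" using q unfolding qk by simp
  hence "k = complex_of_real (Re k)" by (simp add: complex_eq_iff)
  \<comment> \<open>The entries of \<open>v\<close> may be complex; a real eigenvector is obtained
    instead from \<open>Re k\<close> being a root of the real \<open>char_poly G\<close>.\<close>
  moreover have "char_poly H = map_poly complex_of_real (char_poly G)"
    unfolding H_def by (rule of_real_hom.char_poly_hom[OF G])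
  ultimately have "poly (map_poly complex_of_real (char_poly G)) (complex_of_real (Re k)) = 0"
    using k by metis
  hence "poly (char_poly G) (Re k) = 0" by simp
  hence "eigenvalue G (Re k)" using eigenvalue_root_char_poly[OF G] by simp
  thus thesis using that G unfolding eigenvalue_def eigenvector_def by auto
qed

text \<open>Gram-Schmidt keeps the first vector of a basis. Completing \<open>v\<close> to a basis,
  orthogonalising and normalising therefore leaves a multiple of \<open>v\<close> in column
  0.\<close>

lemma orthogonal_mat_first_col:
  fixes v :: "real vec"
  assumes v: "v \<in> carrier_vec n" and v0: "v \<noteq> 0\<^sub>v n" and n: "n \<noteq> 0"
  obtains W c where "W \<in> carrier_mat n n" "transpose_mat W * W = 1\<^sub>m n" "col W 0 = c \<cdot>\<^sub>v v"
proof -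
  interpret cof_vec_space n "TYPE(real)" .
  define b where "b = basis_completion v"
  note bc = basis_completion[OF v v0, folded b_def]
  have len_b: "length b = n" using bc by auto
  with bc(7) n obtain vs where bv: "b = v # vs" by (cases b) auto
  define ws where "ws = gram_schmidt n b"
  have ws: "set ws \<subseteq> carrier_vec n" "corthogonal ws" "length ws = n"
    using gram_schmidt_result[OF bc(2) bc(4) bc(5) refl, folded ws_def] len_b by auto
  have hd: "ws ! 0 = v"
    using gram_schmidt_hd[OF v, of vs, folded bv] ws(3) n
    unfolding ws_def by (metis hd_conv_nth length_0_conv)
  have wsc: "ws ! i \<in> carrier_vec n" if "i < n" for i using ws that by auto
  define s where "s i = (\<Sum>k<n. (ws ! i $ k)\<^sup>2)" for i
  define W where "W = mat n n (\<lambda>(i, j). ws ! j $ i / sqrt (s j))"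
  \<comment> \<open>The equivalence serves twice: for distinct indices it is orthogonality, for
    equal ones it says that \<open>s i\<close> does not vanish.\<close>
  have orth: "((\<Sum>k<n. ws ! i $ k * ws ! j $ k) = 0) = (i \<noteq> j)" if "i < n" "j < n" for i j
    using corthogonalD[OF ws(2), of i j] ws(3) wsc[OF that(2)] that
    by (auto simp: scalar_prod_def atLeast0LessThan)
  have s0: "s i > 0" if "i < n" for i
  proof -
    have "s i \<noteq> 0" using orth[of i i] that by (auto simp: s_def power2_eq_square)
    moreover have "s i \<ge> 0" unfolding s_def by (intro sum_nonneg) auto
    ultimately show ?thesis by simp
  qed
  have W: "W \<in> carrier_mat n n" by (simp add: W_def)
  have "transpose_mat W * W = 1\<^sub>m n"
  proof (rule eq_matI)
    fix i j assume "i < dim_row (1\<^sub>m n :: real mat)" "j < dim_col (1\<^sub>m n :: real mat)"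
    hence ij: "i < n" "j < n" by auto
    have "(transpose_mat W * W) $$ (i, j) = (\<Sum>k<n. (ws ! i $ k / sqrt (s i)) * (ws ! j $ k / sqrt (s j)))"
      using ij by (auto simp: W_def scalar_prod_def atLeast0LessThan)
    also have "\<dots> = (\<Sum>k<n. ws ! i $ k * ws ! j $ k) / (sqrt (s i) * sqrt (s j))"
      by (simp add: sum_divide_distrib)
    also have "\<dots> = 1\<^sub>m n $$ (i, j)"
    proof (cases "i = j")
      case True
      thus ?thesis using s0[OF ij(1)] ij by (simp add: s_def power2_eq_square)
    next
      case False
      thus ?thesis using orth[OF ij] ij by simp
    qed
    finally show "(transpose_mat W * W) $$ (i, j) = 1\<^sub>m n $$ (i, j)" .
  qed (auto simp: W_def)
  moreover have "col W 0 = (1 / sqrt (s 0)) \<cdot>\<^sub>v v"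
    using n v hd by (intro eq_vecI) (auto simp: W_def)
  ultimately show thesis using that W by blast
qed

text \<open>Deflation: an orthogonal \<open>W\<close> whose first column is an eigenvector splits a
  1 by 1 block off \<open>G\<close>, and the remaining symmetric block falls to the induction
  hypothesis.\<close>

theorem real_symmetric_diagonalization:
  fixes G :: "real mat"
  assumes "G \<in> carrier_mat n n" "transpose_mat G = G"
  shows "\<exists>P \<in> carrier_mat n n. transpose_mat P * P = 1\<^sub>m n \<and> diagonal_mat (transpose_mat P * G * P)"
  using assms
proof (induction n arbitrary: G)
  case 0
  thus ?case by (intro bexI[of _ "1\<^sub>m 0"]) (auto simp: diagonal_mat_def)
next
  case (Suc n G)
  note G = Suc.prems(1) and sym = Suc.prems(2)
  obtain e v where v: "v \<in> carrier_vec (Suc n)" "v \<noteq> 0\<^sub>v (Suc n)" "G *\<^sub>v v = e \<cdot>\<^sub>v v"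
    using real_symmetric_eigenvector_exists[OF G sym nat.distinct(2)] by blast
  obtain W c where W: "W \<in> carrier_mat (Suc n) (Suc n)" "transpose_mat W * W = 1\<^sub>m (Suc n)"
      "col W 0 = c \<cdot>\<^sub>v v"
    using orthogonal_mat_first_col[OF v(1,2) nat.distinct(2)] by blast
  define A where "A = transpose_mat W * G * W"
  have A: "A \<in> carrier_mat (Suc n) (Suc n)" using W G by (simp add: A_def)
  have Asym: "transpose_mat A = A"
    using W(1) G sym unfolding A_def
    by (simp add: transpose_mult[of _ "Suc n" "Suc n" _ "Suc n"] assoc_mult_mat[of _ "Suc n" "Suc n" _ "Suc n" _ "Suc n"])
  \<comment> \<open>Column 0 of \<open>W\<close> is a multiple of an eigenvector, so the entry is
    \<open>e\<close> times the inner product of two distinct orthonormal columns. Symmetry then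
    clears the first row.\<close>
  have Ai0: "A $$ (i, 0) = 0" if i: "0 < i" "i < Suc n" for i
  proof -
    have "A $$ (i, 0) = (transpose_mat W * (G * W)) $$ (i, 0)"
      using W G by (simp add: A_def assoc_mult_mat[of _ "Suc n" "Suc n" _ "Suc n" _ "Suc n"])
    also have "\<dots> = col W i \<bullet> col (G * W) 0"
      using i W(1) G by (subst index_mult_mat) (auto)
    also have "col (G * W) 0 = e \<cdot>\<^sub>v col W 0"
      using v W G by (subst col_mult2[of _ "Suc n" "Suc n" _ "Suc n"])
        (auto simp: mult_mat_vec smult_smult_assoc mult.commute)
    also have "col W i \<bullet> (e \<cdot>\<^sub>v col W 0) = e * (transpose_mat W * W) $$ (i, 0)"
      using i W(1) by (subst index_mult_mat) (auto simp del: col_transpose)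
    also have "\<dots> = 0" using i by (simp add: W(2))
    finally show ?thesis .
  qed
  have A0i: "A $$ (0, i) = 0" if i: "0 < i" "i < Suc n" for i
    using Ai0[OF i] arg_cong[OF Asym, of "\<lambda>B. B $$ (0, i)"] A i by auto
  define A1 where "A1 = mat 1 1 (\<lambda>_. A $$ (0, 0))"
  define D where "D = mat n n (\<lambda>(i, j). A $$ (Suc i, Suc j))"
  have c1: "A1 \<in> carrier_mat 1 1" "D \<in> carrier_mat n n" by (auto simp: A1_def D_def)
  have Ablock: "A = four_block_mat A1 (0\<^sub>m 1 n) (0\<^sub>m n 1) D"
    using A Ai0 A0i by (intro eq_matI) (auto simp: A1_def D_def)
  have "transpose_mat D = D"
  proof (rule eq_matI)
    fix i j assume "i < dim_row D" "j < dim_col D"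
    hence ij: "i < n" "j < n" by (auto simp: D_def)
    have "A $$ (Suc j, Suc i) = A $$ (Suc i, Suc j)"
      using arg_cong[OF Asym, of "\<lambda>B. B $$ (Suc i, Suc j)"] A ij by auto
    thus "transpose_mat D $$ (i, j) = D $$ (i, j)" using ij by (simp add: D_def)
  qed (auto simp: D_def)
  from Suc.IH[OF c1(2) this] obtain P where P: "P \<in> carrier_mat n n"
    "transpose_mat P * P = 1\<^sub>m n" "diagonal_mat (transpose_mat P * D * P)" by auto
  define Q where "Q = four_block_mat (1\<^sub>m 1) (0\<^sub>m 1 n) (0\<^sub>m n 1) P"
  have Q: "Q \<in> carrier_mat (Suc n) (Suc n)" using P(1) unfolding Q_def
    using four_block_carrier_mat[of "1\<^sub>m 1" 1 1 P n n] by simp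
  have QT: "transpose_mat Q = four_block_mat (1\<^sub>m 1) (0\<^sub>m 1 n) (0\<^sub>m n 1) (transpose_mat P)"
    using P(1) unfolding Q_def by (subst transpose_four_block_mat[of _ 1 1 _ n _ n]) auto
  have QQ: "transpose_mat Q * Q = 1\<^sub>m (Suc n)"
    unfolding QT unfolding Q_def using P(1,2)
    by (subst mult_four_block_mat[of _ 1 1 _ n _ n _ _ 1 _ n]) auto
  have QAQ: "transpose_mat Q * A * Q = four_block_mat A1 (0\<^sub>m 1 n) (0\<^sub>m n 1) (transpose_mat P * D * P)"
    unfolding QT Ablock unfolding Q_def using P(1) c1
    by (simp add: mult_four_block_mat[of _ 1 1 _ n _ n _ _ 1 _ n])
  \<comment> \<open>Stated for every \<open>B\<close>: the identity matrix gives orthogonality of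
    \<open>W * Q\<close>, and \<open>G\<close> gives the diagonal form.\<close>
  have eq: "transpose_mat (W * Q) * B * (W * Q) = transpose_mat Q * (transpose_mat W * B * W) * Q"
    if "B \<in> carrier_mat (Suc n) (Suc n)" for B
    using W(1) Q that
    by (simp add: transpose_mult[of _ "Suc n" "Suc n" _ "Suc n"] assoc_mult_mat[of _ "Suc n" "Suc n" _ "Suc n" _ "Suc n"])
  have "transpose_mat (W * Q) * (W * Q) = 1\<^sub>m (Suc n)"
    using eq[of "1\<^sub>m (Suc n)"] W Q QQ by simp
  moreover have "diagonal_mat (transpose_mat (W * Q) * G * (W * Q))"
    unfolding eq[OF G] A_def[symmetric] QAQ using P(1,3) c1 by (auto simp: diagonal_mat_def)
  ultimately show ?case using W(1) Q by (intro bexI[of _ "W * Q"]) auto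
qed

section \<open>Singular values and duality of the nuclear and operator norms\<close>

text \<open>Weighting distinct roots by multiplicity amounts to running through the linear factors
  with repetition. This lets \<open>nuclear_norm\<close> be read off a diagonal matrix.\<close>

lemma sum_order_linear_factors:
  fixes as :: "real list" and f :: "real \<Rightarrow> real"
  assumes p: "p = (\<Prod>a\<leftarrow>as. [:- a, 1:])"
  shows "(\<Sum>e\<in>{e. poly p e = 0}. real (Polynomial.order e p) * f e) = sum_list (map f as)"
proof -
  have order: "Polynomial.order e (\<Prod>a\<leftarrow>as. [:- a, 1:]) = count_list as e" for e
  proof (induction as)
    case (Cons a as)
    have nz: "[:- a, 1:] * (\<Prod>a\<leftarrow>as. [:- a, 1:]) \<noteq> 0"
      unfolding mult_eq_0_iff by (auto simp: prod_list_zero_iff)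
    have "Polynomial.order e [:- a, 1:] = (if a = e then 1 else 0)"
      using order_power_n_n[of e 1] by (auto simp: order_root intro: order_0I)
    thus ?case using Cons nz by (auto simp: order_mult simp del: mult_pCons_left)
  qed (simp add: order_0I)
  have roots: "{e. poly p e = 0} = set as"
    unfolding p by (induction as) auto
  have "(\<Sum>e\<in>{e. poly p e = 0}. real (Polynomial.order e p) * f e) = (\<Sum>e\<in>set as. real (count_list as e) * f e)"
    unfolding roots by (simp add: p order)
  \<comment> \<open>The index set is relaxed to a fixed finite superset \<open>S\<close>, because
    \<open>set as\<close> changes along the induction.\<close>
  also have "(\<Sum>e\<in>S. real (count_list as e) * f e) = sum_list (map f as)"
    if "finite S" "set as \<subseteq> S" for S
    using that(2)
  proof (induction as)
    case (Cons a as)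
    have "(\<Sum>e\<in>S. real (count_list (a # as) e) * f e) =
        (\<Sum>e\<in>S. (if a = e then f e else 0) + real (count_list as e) * f e)"
      by (intro sum.cong) (auto simp: algebra_simps)
    thus ?case using Cons that(1) by (simp add: sum.distrib)
  qed simp
  from this[OF finite_set subset_refl]
  have "(\<Sum>e\<in>set as. real (count_list as e) * f e) = sum_list (map f as)" .
  finally show ?thesis .
qed

text \<open>\<open>P\<close> diagonalises the Gram matrix of \<open>X\<close>. The diagonal form is
  the Gram matrix of \<open>X * P\<close>, so the column lengths of \<open>X * P\<close> are the
  singular values.\<close>

lemma nuclear_norm_singular_vectors:
  fixes X :: "real mat"
  assumes X: "X \<in> carrier_mat m n"
  obtains P where "P \<in> carrier_mat n n" "transpose_mat P * P = 1\<^sub>m n" "P * transpose_mat P = 1\<^sub>m n"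
    "nuclear_norm X = (\<Sum>k<n. sqrt (\<Sum>i<m. ((X * P) $$ (i, k))\<^sup>2))"
proof -
  define G where "G = transpose_mat X * X"
  have G: "G \<in> carrier_mat n n" and sym: "transpose_mat G = G"
    using X by (auto simp: G_def transpose_mult[of _ n m _ n])
  obtain P where P: "P \<in> carrier_mat n n" "transpose_mat P * P = 1\<^sub>m n"
    "diagonal_mat (transpose_mat P * G * P)"
    using real_symmetric_diagonalization[OF G sym] by auto
  have PP: "P * transpose_mat P = 1\<^sub>m n"
    using mat_mult_left_right_inverse[of "transpose_mat P" n P] P by auto
  define B where "B = transpose_mat P * G * P"
  have B: "B \<in> carrier_mat n n" using P G by (simp add: B_def)
  have "similar_mat B G"
    by (rule similar_matI[of _ _ "transpose_mat P" P n]) (use P PP B G in \<open>auto simp: B_def\<close>)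
  hence "char_poly G = char_poly B" by (metis char_poly_similar)
  also have "\<dots> = (\<Prod>a\<leftarrow>diag_mat B. [:- a, 1:])"
    using P(3) B by (intro char_poly_upper_triangular[OF B])
      (auto simp: B_def[symmetric] diagonal_mat_def)
  finally have "nuclear_norm X = sum_list (map sqrt (diag_mat B))"
    unfolding nuclear_norm_def Let_def G_def[symmetric]
    by (rule sum_order_linear_factors)
  also have "\<dots> = (\<Sum>k<n. sqrt (B $$ (k, k)))"
    using B by (simp add: diag_mat_def interv_sum_list_conv_sum_set_nat o_def atLeast0LessThan)
  also have "\<dots> = (\<Sum>k<n. sqrt (\<Sum>i<m. ((X * P) $$ (i, k))\<^sup>2))"
  proof (intro sum.cong refl arg_cong[where f = sqrt])
    fix k assume "k \<in> {..<n}"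
    hence k: "k < n" by simp
    have "B = transpose_mat (X * P) * (X * P)"
      using X P by (simp add: B_def G_def transpose_mult[of _ m n _ n]
          assoc_mult_mat[of _ n n _ n _ n] assoc_mult_mat[of _ n n _ m _ n]
          assoc_mult_mat[of _ n m _ n _ n])
    hence "B $$ (k, k) = col (X * P) k \<bullet> col (X * P) k" using X P k by auto
    also have "\<dots> = (\<Sum>i<m. ((X * P) $$ (i, k))\<^sup>2)"
      using X P k by (simp add: scalar_prod_def atLeast0LessThan power2_eq_square)
    finally show "B $$ (k, k) = (\<Sum>i<m. ((X * P) $$ (i, k))\<^sup>2)" .
  qed
  finally show thesis using that P PP by blast
qed

text \<open>\<open>b\<close> bounds the operator norm of \<open>W\<close>. Writing
  \<open>X = Y * transpose_mat P\<close> splits \<open>X\<close> into rank-one terms, each a column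
  of \<open>Y\<close> times a unit column of \<open>P\<close>; the column lengths of
  \<open>Y\<close> add up to the nuclear norm.\<close>

lemma nuclear_norm_duality:
  fixes X :: "real mat" and W :: "nat \<Rightarrow> nat \<Rightarrow> real"
  assumes X: "X \<in> carrier_mat m n"
    and W: "\<And>u v. (\<Sum>i<m. (u i)\<^sup>2) \<le> 1 \<Longrightarrow> (\<Sum>j<n. (v j)\<^sup>2) \<le> 1 \<Longrightarrow>
              (\<Sum>i<m. \<Sum>j<n. u i * W i j * v j) \<le> b"
  shows "(\<Sum>i<m. \<Sum>j<n. W i j * X $$ (i, j)) \<le> b * nuclear_norm X"
proof -
  obtain P where P: "P \<in> carrier_mat n n" "transpose_mat P * P = 1\<^sub>m n" "P * transpose_mat P = 1\<^sub>m n"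
    and nn: "nuclear_norm X = (\<Sum>k<n. sqrt (\<Sum>i<m. ((X * P) $$ (i, k))\<^sup>2))"
    using nuclear_norm_singular_vectors[OF X] by blast
  define Y where "Y = X * P"
  have Y: "Y \<in> carrier_mat m n" using X P by (simp add: Y_def)
  have "X = Y * transpose_mat P"
    using X P by (simp add: Y_def assoc_mult_mat[of _ m n _ n _ n])
  hence Xij: "X $$ (i, j) = (\<Sum>k<n. Y $$ (i, k) * P $$ (j, k))" if "i < m" "j < n" for i j
    using Y P that by (simp add: scalar_prod_def atLeast0LessThan)
  have Pk: "(\<Sum>j<n. (P $$ (j, k))\<^sup>2) = 1" if "k < n" for k
    using arg_cong[OF P(2), of "\<lambda>A. A $$ (k, k)"] P(1) that
    by (simp add: scalar_prod_def atLeast0LessThan power2_eq_square)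
  have col: "(\<Sum>i<m. \<Sum>j<n. Y $$ (i, k) * W i j * P $$ (j, k)) \<le> b * sqrt (\<Sum>i<m. (Y $$ (i, k))\<^sup>2)"
    if k: "k < n" for k
  proof -
    \<comment> \<open>Division by \<open>r\<close> makes the column a unit vector, to which the
      bound on \<open>W\<close> applies; a zero column contributes nothing and is treated
      apart.\<close>
    define r where "r = sqrt (\<Sum>i<m. (Y $$ (i, k))\<^sup>2)"
    have r2: "r\<^sup>2 = (\<Sum>i<m. (Y $$ (i, k))\<^sup>2)" unfolding r_def by (simp add: sum_nonneg)
    show ?thesis
    proof (cases "r = 0")
      case True
      hence "(\<Sum>i<m. (Y $$ (i, k))\<^sup>2) = 0" using r2 by simp
      hence "\<forall>i<m. Y $$ (i, k) = 0" by (subst (asm) sum_nonneg_eq_0_iff) auto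
      thus ?thesis by simp
    next
      case False
      have r0: "r > 0" using False unfolding r_def by (simp add: sum_nonneg less_le)
      have "(\<Sum>i<m. \<Sum>j<n. (Y $$ (i, k) / r) * W i j * P $$ (j, k)) \<le> b"
      proof (rule W)
        show "(\<Sum>i<m. (Y $$ (i, k) / r)\<^sup>2) \<le> 1"
          using False by (simp add: power_divide sum_divide_distrib[symmetric] r2[symmetric])
      qed (simp add: Pk[OF k])
      also have "(\<Sum>i<m. \<Sum>j<n. (Y $$ (i, k) / r) * W i j * P $$ (j, k)) =
          (\<Sum>i<m. \<Sum>j<n. Y $$ (i, k) * W i j * P $$ (j, k)) / r"
        by (simp add: sum_divide_distrib)
      finally show ?thesis using r0 by (simp add: field_simps r_def[symmetric])
    qed
  qed
  have "(\<Sum>i<m. \<Sum>j<n. W i j * X $$ (i, j)) =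
      (\<Sum>i<m. \<Sum>j<n. \<Sum>k<n. Y $$ (i, k) * W i j * P $$ (j, k))"
    by (intro sum.cong refl) (simp add: Xij sum_distrib_left mult_ac)
  also have "\<dots> = (\<Sum>i<m. \<Sum>k<n. \<Sum>j<n. Y $$ (i, k) * W i j * P $$ (j, k))"
    by (intro sum.cong refl sum.swap)
  also have "\<dots> = (\<Sum>k<n. \<Sum>i<m. \<Sum>j<n. Y $$ (i, k) * W i j * P $$ (j, k))"
    by (rule sum.swap)
  also have "\<dots> \<le> (\<Sum>k<n. b * sqrt (\<Sum>i<m. (Y $$ (i, k))\<^sup>2))"
    by (intro sum_mono col) auto
  also have "\<dots> = b * nuclear_norm X" by (simp add: nn Y_def sum_distrib_left)
  finally show ?thesis .
qed

lemma nuclear_norm_zero [simp]: "nuclear_norm (0\<^sub>m m n) = 0"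
proof -
  obtain P where P: "P \<in> carrier_mat n n"
    and nn: "nuclear_norm (0\<^sub>m m n) = (\<Sum>k<n. sqrt (\<Sum>i<m. ((0\<^sub>m m n * P) $$ (i, k))\<^sup>2))"
    using nuclear_norm_singular_vectors[of "0\<^sub>m m n" m n] by auto
  show ?thesis using P by (simp add: nn)
qed

section \<open>Integer points and bilinear forms\<close>

lemma abs_le_power2_int: "\<bar>k\<bar> \<le> k\<^sup>2" for k :: int
  using mult_mono[of 1 "\<bar>k\<bar>" "\<bar>k\<bar>" "\<bar>k\<bar>"] by (cases "k = 0") (auto simp: power2_eq_square)

text \<open>The radius leaves room for every coordinatewise rounding of a real point of squared
  length at most \<open>m\<close>. Extensional functions make the set finite.\<close>

definition lattice_ball :: "nat \<Rightarrow> (nat \<Rightarrow> int) set" where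
  "lattice_ball m = {z \<in> {..<m} \<rightarrow>\<^sub>E UNIV. (\<Sum>i<m. (z i)\<^sup>2) \<le> 4 * int m}"

text \<open>The box is crude, but as a product set it lets the weighted sum in the counting argument
  factorise.\<close>

lemma lattice_ball_subset: "lattice_ball m \<subseteq> {..<m} \<rightarrow>\<^sub>E {-int (4 * m)..int (4 * m)}"
proof
  fix z assume z: "z \<in> lattice_ball m"
  have "\<bar>z i\<bar> \<le> int (4 * m)" if "i < m" for i
  proof -
    have "\<bar>z i\<bar> \<le> (z i)\<^sup>2"
      by (rule abs_le_power2_int)
    also have "\<dots> \<le> (\<Sum>i<m. (z i)\<^sup>2)" using that by (intro member_le_sum) auto
    also have "\<dots> \<le> int (4 * m)" using z by (simp add: lattice_ball_def)
    finally show ?thesis .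
  qed
  hence "z i \<in> {-int (4 * m)..int (4 * m)}" if "i < m" for i
    using that by (meson abs_le_D1 abs_le_D2 atLeastAtMost_iff minus_le_iff)
  thus "z \<in> {..<m} \<rightarrow>\<^sub>E {-int (4 * m)..int (4 * m)}"
    using z by (intro PiE_I) (auto simp: lattice_ball_def simp del: atLeastAtMost_iff)
qed

lemma finite_lattice_ball [simp]: "finite (lattice_ball m)"
  by (rule finite_subset[OF lattice_ball_subset]) (auto intro: finite_PiE)

lemma sum_half_power_abs:
  "(\<Sum>k\<in>{-int N..int N}. (1 / 2 :: real) ^ nat \<bar>k\<bar>) = 3 - 2 * (1 / 2) ^ N"
proof (induction N)
  case (Suc N)
  have "{-int (Suc N)..int (Suc N)} = insert (- int (Suc N)) (insert (int (Suc N)) {-int N..int N})"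
    by auto
  moreover have "nat (1 + int N) = Suc N" "nat (int N + 1) = Suc N" by simp_all
  ultimately show ?case using Suc by simp
qed simp

text \<open>Counting by exponential weights: each point of the ball has weight
  \<open>16 ^ m * (\<Prod>i<m. g (z i))\<close>, at least 1 because its squares sum to at most
  \<open>4 * m\<close> and \<open>2 ^ 4 = 16\<close>. Over the box the weights factorise, with at
  most \<open>16 * 3\<close> per coordinate.\<close>

lemma card_lattice_ball: "real (card (lattice_ball m)) \<le> 48 ^ m"
proof -
  define K where "K = {-int (4 * m)..int (4 * m)}"
  define g where "g k = (1 / 2 :: real) ^ nat (k\<^sup>2)" for k :: int
  have "1 \<le> 16 ^ m * (\<Prod>i<m. g (z i))" if z: "z \<in> lattice_ball m" for z
  proof -
    have "int (\<Sum>i<m. nat ((z i)\<^sup>2)) = (\<Sum>i<m. (z i)\<^sup>2)" by simp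
    also have "\<dots> \<le> int (4 * m)" using z by (simp add: lattice_ball_def)
    finally have le: "(\<Sum>i<m. nat ((z i)\<^sup>2)) \<le> 4 * m" by linarith
    have "(1 / 2 :: real) ^ (4 * m) \<le> (1 / 2) ^ (\<Sum>i<m. nat ((z i)\<^sup>2))"
      by (rule power_decreasing[OF le]) auto
    also have "\<dots> = (\<Prod>i<m. g (z i))" by (simp add: g_def power_sum)
    finally have "16 ^ m * (1 / 2 :: real) ^ (4 * m) \<le> 16 ^ m * (\<Prod>i<m. g (z i))" by simp
    moreover have "16 ^ m * (1 / 2 :: real) ^ (4 * m) = 1"
      by (simp add: power_mult power_divide)
    ultimately show ?thesis by simp
  qed
  hence "real (card (lattice_ball m)) \<le> (\<Sum>z\<in>lattice_ball m. 16 ^ m * (\<Prod>i<m. g (z i)))"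
    using sum_mono[of "lattice_ball m" "\<lambda>_. 1 :: real"] by simp
  also have "\<dots> \<le> (\<Sum>z\<in>{..<m} \<rightarrow>\<^sub>E K. 16 ^ m * (\<Prod>i<m. g (z i)))"
    by (intro sum_mono2 finite_PiE) (use lattice_ball_subset in \<open>auto simp: K_def g_def intro!: prod_nonneg mult_nonneg_nonneg\<close>)
  also have "\<dots> = 16 ^ m * (\<Prod>i<m. \<Sum>k\<in>K. g k)"
    by (subst prod_sum_PiE) (auto simp: K_def sum_distrib_left)
  also have "\<dots> \<le> 16 ^ m * 3 ^ m"
  proof -
    \<comment> \<open>Since \<open>\<bar>k\<bar> \<le> k\<^sup>2\<close>, the sum is dominated by a
      two-sided geometric series.\<close>
    have "(\<Sum>k\<in>K. g k) \<le> (\<Sum>k\<in>K. (1 / 2) ^ nat \<bar>k\<bar>)"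
    proof (rule sum_mono)
      fix k :: int
      have "\<bar>k\<bar> \<le> k\<^sup>2" by (rule abs_le_power2_int)
      hence "nat \<bar>k\<bar> \<le> nat (k\<^sup>2)" by (rule nat_mono)
      thus "g k \<le> (1 / 2) ^ nat \<bar>k\<bar>" unfolding g_def by (rule power_decreasing) auto
    qed
    also have "\<dots> \<le> 3" unfolding K_def sum_half_power_abs by simp
    finally have "(\<Sum>k\<in>K. g k) ^ m \<le> 3 ^ m"
      by (intro power_mono sum_nonneg) (auto simp: g_def)
    thus ?thesis by simp
  qed
  also have "\<dots> = 48 ^ m" using power_mult_distrib[of "16 :: real" 3 m] by simp
  finally show ?thesis .
qed

text \<open>A linear form is maximised by rounding each coordinate in the direction of the
  sign of its coefficient, so the integer points capture the maximum without any approximation.\<close>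

lemma lattice_ball_rounding:
  fixes x c :: "nat \<Rightarrow> real"
  assumes x: "(\<Sum>i<m. (x i)\<^sup>2) \<le> real m"
  obtains z where "z \<in> lattice_ball m" "(\<Sum>i<m. c i * x i) \<le> (\<Sum>i<m. c i * real_of_int (z i))"
proof
  define z where "z = restrict (\<lambda>i. if c i \<ge> 0 then \<lceil>x i\<rceil> else \<lfloor>x i\<rfloor>) {..<m}"
  show "(\<Sum>i<m. c i * x i) \<le> (\<Sum>i<m. c i * real_of_int (z i))"
    by (intro sum_mono) (auto simp: z_def mult_left_mono mult_left_mono_neg)
  have z2: "(real_of_int (z i))\<^sup>2 \<le> 2 * (x i)\<^sup>2 + 2" if "i < m" for i
  proof -
    define d where "d = real_of_int (z i) - x i"
    have "\<bar>d\<bar> \<le> 1" using that unfolding d_def z_def by (auto; linarith)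
    hence "d\<^sup>2 \<le> 1" by (simp add: abs_square_le_1)
    \<comment> \<open>Parallelogram identity. Dropping the second square gives the bound, and
      summing it gives the \<open>4 * m\<close> of \<open>lattice_ball\<close>.\<close>
    moreover have "(x i + d)\<^sup>2 + (x i - d)\<^sup>2 = 2 * (x i)\<^sup>2 + 2 * d\<^sup>2"
      by (simp add: power2_eq_square algebra_simps)
    ultimately have "(x i + d)\<^sup>2 \<le> 2 * (x i)\<^sup>2 + 2"
      using zero_le_power2[of "x i - d"] by linarith
    thus ?thesis by (simp add: d_def)
  qed
  have "real_of_int (\<Sum>i<m. (z i)\<^sup>2) \<le> (\<Sum>i<m. 2 * (x i)\<^sup>2 + 2)"
    unfolding of_int_sum of_int_power by (intro sum_mono z2) auto
  also have "\<dots> \<le> real_of_int (4 * int m)"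
    using x by (simp add: sum.distrib flip: sum_distrib_left)
  finally have "(\<Sum>i<m. (z i)\<^sup>2) \<le> 4 * int m" by (simp only: of_int_le_iff)
  thus "z \<in> lattice_ball m" by (auto simp: lattice_ball_def z_def)
qed

text \<open>The form is linear in each argument: the first vector is rounded with the second fixed,
  then the second with the rounded first fixed, and neither move decreases the value. The divisor
  undoes the scaling to lengths \<open>sqrt m\<close> and \<open>sqrt n\<close>.\<close>

lemma bilinear_form_le_lattice_bound:
  fixes W :: "nat \<Rightarrow> nat \<Rightarrow> real"
  assumes "0 < m" "0 < n"
    and b: "\<And>z w. z \<in> lattice_ball m \<Longrightarrow> w \<in> lattice_ball n \<Longrightarrow>
      (\<Sum>i<m. \<Sum>j<n. real_of_int (z i) * W i j * real_of_int (w j)) / sqrt (real m * real n) \<le> b"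
    and u: "(\<Sum>i<m. (u i)\<^sup>2) \<le> 1" and v: "(\<Sum>j<n. (v j)\<^sup>2) \<le> 1"
  shows "(\<Sum>i<m. \<Sum>j<n. u i * W i j * v j) \<le> b"
proof -
  define x where "x i = sqrt (real m) * u i" for i
  define y where "y j = sqrt (real n) * v j" for j
  have x: "(\<Sum>i<m. (x i)\<^sup>2) \<le> real m"
    using mult_left_mono[OF u, of "real m"] by (simp add: x_def power_mult_distrib sum_distrib_left)
  have y: "(\<Sum>j<n. (y j)\<^sup>2) \<le> real n"
    using mult_left_mono[OF v, of "real n"] by (simp add: y_def power_mult_distrib sum_distrib_left)
  obtain z where z: "z \<in> lattice_ball m"
    "(\<Sum>i<m. (\<Sum>j<n. W i j * y j) * x i) \<le> (\<Sum>i<m. (\<Sum>j<n. W i j * y j) * real_of_int (z i))"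
    using lattice_ball_rounding[OF x, of "\<lambda>i. \<Sum>j<n. W i j * y j"] by blast
  obtain w where w: "w \<in> lattice_ball n"
    "(\<Sum>j<n. (\<Sum>i<m. real_of_int (z i) * W i j) * y j) \<le>
     (\<Sum>j<n. (\<Sum>i<m. real_of_int (z i) * W i j) * real_of_int (w j))"
    using lattice_ball_rounding[OF y, of "\<lambda>j. \<Sum>i<m. real_of_int (z i) * W i j"] by blast
  have s0: "sqrt (real m * real n) > 0" using assms(1,2) by simp
  have "(\<Sum>i<m. \<Sum>j<n. u i * W i j * v j) * sqrt (real m * real n) = (\<Sum>i<m. (\<Sum>j<n. W i j * y j) * x i)"
    by (simp add: sum_distrib_right sum_distrib_left x_def y_def real_sqrt_mult mult_ac)
  also have "\<dots> \<le> (\<Sum>i<m. (\<Sum>j<n. W i j * y j) * real_of_int (z i))" by (rule z(2))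
  also have "\<dots> = (\<Sum>j<n. (\<Sum>i<m. real_of_int (z i) * W i j) * y j)"
    by (simp add: sum_distrib_right sum_distrib_left mult_ac) (rule sum.swap)
  also have "\<dots> \<le> (\<Sum>j<n. (\<Sum>i<m. real_of_int (z i) * W i j) * real_of_int (w j))" by (rule w(2))
  also have "\<dots> = (\<Sum>i<m. \<Sum>j<n. real_of_int (z i) * W i j * real_of_int (w j))"
    by (simp add: sum_distrib_right) (rule sum.swap)
  also have "\<dots> \<le> b * sqrt (real m * real n)"
    using b[OF z(1) w(1)] s0 by (simp add: pos_divide_le_eq)
  finally show ?thesis using s0 by simp
qed

section \<open>Concentration on product distributions\<close>

lemma finite_set_Pi_pmf:
  assumes "finite A" "\<And>i. i \<in> A \<Longrightarrow> finite (set_pmf (p i))"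
  shows "finite (set_pmf (Pi_pmf A dflt p))"
  using assms by (subst set_Pi_pmf) (auto intro: finite_PiE_dflt)

text \<open>Fubini for a single coordinate, used to peel coordinates off in the induction for
  McDiarmid's inequality. Finite supports supply integrability.\<close>

lemma expectation_Pi_pmf_insert:
  fixes h :: "('a \<Rightarrow> 'b) \<Rightarrow> real"
  assumes A: "finite A" "x \<notin> A" and fin: "\<And>i. i \<in> insert x A \<Longrightarrow> finite (set_pmf (p i))"
  shows "measure_pmf.expectation (Pi_pmf (insert x A) dflt p) h =
    measure_pmf.expectation (p x) (\<lambda>y. measure_pmf.expectation (Pi_pmf A dflt p) (\<lambda>w. h (w(x := y))))"
proof -
  have "Pi_pmf (insert x A) dflt p = p x \<bind> (\<lambda>y. map_pmf (\<lambda>w. w(x := y)) (Pi_pmf A dflt p))"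
    using A by (simp add: Pi_pmf_insert' map_pmf_def)
  also have "measure_pmf.expectation \<dots> h = (\<Sum>y\<in>set_pmf (p x). pmf (p x) y *\<^sub>R
      measure_pmf.expectation (map_pmf (\<lambda>w. w(x := y)) (Pi_pmf A dflt p)) h)"
    using A fin by (intro pmf_expectation_bind) (auto intro!: finite_set_Pi_pmf)
  also have "\<dots> = measure_pmf.expectation (p x) (\<lambda>y. measure_pmf.expectation (Pi_pmf A dflt p) (\<lambda>w. h (w(x := y))))"
    using fin by (subst integral_measure_pmf[of "set_pmf (p x)"]) auto
  finally show ?thesis .
qed

text \<open>Hoeffding's lemma on the range of \<open>g\<close> over the support. The one-sided bound
  holds for all ordered pairs, so it bounds the width of that range.\<close>

lemma Hoeffding_mgf_pmf:
  fixes g :: "'a \<Rightarrow> real"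
  assumes fin: "finite (set_pmf p)" and l: "l > 0"
    and osc: "\<And>x y. g x - g y \<le> c"
  shows "measure_pmf.expectation p (\<lambda>x. exp (l * g x)) \<le>
    exp (l * measure_pmf.expectation p g + l\<^sup>2 * c\<^sup>2 / 8)"
proof -
  define a where "a = Min (g ` set_pmf p)"
  define b where "b = Max (g ` set_pmf p)"
  define \<mu> where "\<mu> = measure_pmf.expectation p g"
  have ab: "a \<in> g ` set_pmf p" "b \<in> g ` set_pmf p"
    unfolding a_def b_def using fin by (auto intro!: Min_in Max_in simp: set_pmf_not_empty)
  have "a \<le> b" unfolding a_def b_def using fin ab by (metis Max_ge a_def finite_imageI)
  moreover have "b - a \<le> c" using ab osc by auto
  ultimately have ba: "(b - a)\<^sup>2 \<le> c\<^sup>2" by (intro power_mono) auto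
  interpret interval_bounded_random_variable "measure_pmf p" g a b
    by unfold_locales (auto simp: AE_measure_pmf_iff a_def b_def fin)
  have "ennreal (measure_pmf.expectation p (\<lambda>x. exp (l * (g x - \<mu>)))) =
      nn_integral (measure_pmf p) (\<lambda>x. ennreal (exp (l * (g x - \<mu>))))"
    by (intro nn_integral_eq_integral[symmetric] integrable_measure_pmf_finite fin) auto
  also have "\<dots> \<le> ennreal (exp (l\<^sup>2 * (b - a)\<^sup>2 / 8))"
    unfolding \<mu>_def by (rule Hoeffdings_lemma_nn_integral[OF l])
  finally have "measure_pmf.expectation p (\<lambda>x. exp (l * (g x - \<mu>))) \<le> exp (l\<^sup>2 * (b - a)\<^sup>2 / 8)"
    by simp
  also have "\<dots> \<le> exp (l\<^sup>2 * c\<^sup>2 / 8)"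
    using ba by (simp add: mult_left_mono divide_right_mono)
  finally have *: "measure_pmf.expectation p (\<lambda>x. exp (l * (g x - \<mu>))) \<le> exp (l\<^sup>2 * c\<^sup>2 / 8)" .
  have "measure_pmf.expectation p (\<lambda>x. exp (l * g x)) =
      exp (l * \<mu>) * measure_pmf.expectation p (\<lambda>x. exp (l * (g x - \<mu>)))"
    by (simp add: exp_add[symmetric] algebra_simps flip: integral_mult_right_zero)
  also have "\<dots> \<le> exp (l * \<mu>) * exp (l\<^sup>2 * c\<^sup>2 / 8)"
    using * by (intro mult_left_mono) auto
  finally show ?thesis by (simp add: exp_add \<mu>_def)
qed

text \<open>With coordinate \<open>i\<close> frozen at \<open>y\<close>, the induction hypothesis
  bounds the conditional moment generating function through the conditional mean \<open>g y\<close>.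
  Hoeffding's lemma for \<open>g\<close> then adds the contribution of \<open>c i\<close>.\<close>

theorem McDiarmid_mgf:
  fixes f :: "('a \<Rightarrow> 'b) \<Rightarrow> real"
  assumes "finite I" and "\<And>i. i \<in> I \<Longrightarrow> finite (set_pmf (p i))" and l: "l > 0"
    and "\<And>i w x y. i \<in> I \<Longrightarrow> f (w(i := x)) - f (w(i := y)) \<le> c i"
  shows "measure_pmf.expectation (Pi_pmf I dflt p) (\<lambda>w. exp (l * f w)) \<le>
    exp (l * measure_pmf.expectation (Pi_pmf I dflt p) f + l\<^sup>2 * (\<Sum>i\<in>I. (c i)\<^sup>2) / 8)"
  using assms(1,2,4)
proof (induction I arbitrary: f rule: finite_induct)
  case empty
  thus ?case by simp
next
  case (insert i I f)
  let ?E = "measure_pmf.expectation (Pi_pmf I dflt p)"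
  have fin: "finite (set_pmf (Pi_pmf I dflt p))"
    using insert by (intro finite_set_Pi_pmf) auto
  note int = integrable_measure_pmf_finite[OF fin]
  define g where "g y = ?E (\<lambda>w. f (w(i := y)))" for y
  define V where "V = (\<Sum>i\<in>I. (c i)\<^sup>2)"
  have IH: "?E (\<lambda>w. exp (l * f (w(i := y)))) \<le> exp (l * g y + l\<^sup>2 * V / 8)" for y
    unfolding g_def V_def
  proof (rule insert.IH)
    fix j w x x' assume j: "j \<in> I"
    hence "j \<noteq> i" using insert.hyps by auto
    \<comment> \<open>Updates at distinct points commute, so this is a bounded difference of
      \<open>f\<close> at the base point \<open>w(i := y)\<close>.\<close>
    thus "f (w(j := x, i := y)) - f (w(j := x', i := y)) \<le> c j"
      using insert.prems(2)[of j "w(i := y)" x x'] j unfolding fun_upd_twist[OF \<open>j \<noteq> i\<close>] by blast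
  qed (use insert.prems in auto)
  \<comment> \<open>Averaging over the other coordinates preserves the bounded difference in
    coordinate \<open>i\<close>.\<close>
  have osc: "g x - g y \<le> c i" for x y
  proof -
    have "g x - g y = ?E (\<lambda>w. f (w(i := x)) - f (w(i := y)))"
      unfolding g_def by (rule Bochner_Integration.integral_diff[symmetric]) (rule int)+
    also have "\<dots> \<le> ?E (\<lambda>_. c i)"
      by (intro integral_mono int insert.prems(2)) simp
    finally show ?thesis by simp
  qed
  have fini: "finite (set_pmf (p i))" using insert.prems by auto
  note inti = integrable_measure_pmf_finite[OF fini]
  have "measure_pmf.expectation (Pi_pmf (insert i I) dflt p) (\<lambda>w. exp (l * f w)) =
      measure_pmf.expectation (p i) (\<lambda>y. ?E (\<lambda>w. exp (l * f (w(i := y)))))"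
    by (rule expectation_Pi_pmf_insert) (use insert in auto)
  also have "\<dots> \<le> measure_pmf.expectation (p i) (\<lambda>y. exp (l\<^sup>2 * V / 8) * exp (l * g y))"
    by (rule integral_mono) (use IH in \<open>auto simp: inti exp_add mult.commute\<close>)
  also have "\<dots> = exp (l\<^sup>2 * V / 8) * measure_pmf.expectation (p i) (\<lambda>y. exp (l * g y))"
    by simp
  also have "\<dots> \<le> exp (l\<^sup>2 * V / 8) * exp (l * measure_pmf.expectation (p i) g + l\<^sup>2 * (c i)\<^sup>2 / 8)"
    by (intro mult_left_mono Hoeffding_mgf_pmf fini l osc) auto
  also have "measure_pmf.expectation (p i) g = measure_pmf.expectation (Pi_pmf (insert i I) dflt p) f"
    unfolding g_def by (rule expectation_Pi_pmf_insert[symmetric]) (use insert in auto)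
  finally show ?case
    using insert.hyps by (simp add: V_def exp_add[symmetric] algebra_simps add_divide_distrib)
qed

text \<open>Chernoff's method: Markov's inequality for \<open>exp (l * f w)\<close>, where
  \<open>l = 4 * s / V\<close> minimises the exponent
  \<open>l\<^sup>2 * V / 8 - l * s\<close>.\<close>

lemma McDiarmid_tail:
  fixes f :: "('a \<Rightarrow> 'b) \<Rightarrow> real"
  assumes I: "finite I" and fin: "\<And>i. i \<in> I \<Longrightarrow> finite (set_pmf (p i))" and s: "s > 0"
    and diff: "\<And>i w x y. i \<in> I \<Longrightarrow> f (w(i := x)) - f (w(i := y)) \<le> c i"
    and V: "(\<Sum>i\<in>I. (c i)\<^sup>2) > 0"
  shows "measure_pmf.prob (Pi_pmf I dflt p)
      {w. f w \<ge> measure_pmf.expectation (Pi_pmf I dflt p) f + s} \<le> exp (- 2 * s\<^sup>2 / (\<Sum>i\<in>I. (c i)\<^sup>2))"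
proof -
  define P where "P = Pi_pmf I dflt p"
  define V where "V = (\<Sum>i\<in>I. (c i)\<^sup>2)"
  define \<mu> where "\<mu> = measure_pmf.expectation P f"
  define l where "l = 4 * s / V"
  have V0: "V > 0" using V by (simp add: V_def)
  have l: "l > 0" using V0 s by (simp add: l_def)
  have finP: "finite (set_pmf P)" unfolding P_def using I fin by (intro finite_set_Pi_pmf)
  have "{w. f w \<ge> \<mu> + s} = {w\<in>space (measure_pmf P). exp (l * f w) \<ge> exp (l * (\<mu> + s))}"
    using l by auto
  also have "measure_pmf.prob P \<dots> \<le> measure_pmf.expectation P (\<lambda>w. exp (l * f w)) / exp (l * (\<mu> + s))"
    by (rule integral_Markov_inequality_measure[where A = "space (measure_pmf P)"])
      (auto intro: integrable_measure_pmf_finite[OF finP])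
  also have "\<dots> \<le> exp (l * \<mu> + l\<^sup>2 * V / 8) / exp (l * (\<mu> + s))"
    unfolding P_def \<mu>_def V_def by (intro divide_right_mono McDiarmid_mgf I fin l diff) auto
  also have "\<dots> = exp (l\<^sup>2 * V / 8 - l * s)"
    by (simp add: exp_diff[symmetric] algebra_simps)
  also have "l\<^sup>2 * V / 8 - l * s = - 2 * s\<^sup>2 / V"
    using V0 by (simp add: l_def field_simps power2_eq_square)
  finally show ?thesis by (simp add: P_def V_def \<mu>_def)
qed

text \<open>The bound \<open>exp x \<ge> 1 + x\<close> replaces Jensen's inequality here.\<close>

lemma expectation_Max_le:
  fixes f :: "'k \<Rightarrow> 'a \<Rightarrow> real"
  assumes T: "finite T" "T \<noteq> {}" and fin: "finite (set_pmf p)" and l: "l > 0"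
    and mgf: "\<And>k. k \<in> T \<Longrightarrow> measure_pmf.expectation p (\<lambda>x. exp (l * f k x)) \<le> exp K"
  shows "measure_pmf.expectation p (\<lambda>x. Max ((\<lambda>k. f k x) ` T)) \<le> (ln (real (card T)) + K) / l"
proof -
  define M where "M x = Max ((\<lambda>k. f k x) ` T)" for x
  \<comment> \<open>This \<open>c\<close> normalises the sum of exponentials:
    \<open>exp (- c)\<close> times its mean is at most 1, so integrating the pointwise bound leaves
    \<open>c\<close> as a bound for \<open>l\<close> times the mean of \<open>M\<close>.\<close>
  define c where "c = ln (real (card T)) + K"
  have card: "real (card T) > 0" using T by (simp add: card_gt_0_iff)
  note int = integrable_measure_pmf_finite[OF fin]
  have "l * M x - c + 1 \<le> exp (- c) * (\<Sum>k\<in>T. exp (l * f k x))" for x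
  proof -
    have "M x \<in> (\<lambda>k. f k x) ` T" unfolding M_def using T by (intro Max_in) auto
    then obtain k where k: "k \<in> T" "M x = f k x" by auto
    have "l * M x - c + 1 \<le> exp (l * M x - c)" using exp_ge_add_one_self[of "l * M x - c"] by linarith
    also have "\<dots> = exp (- c) * exp (l * f k x)" by (simp add: k exp_add[symmetric])
    also have "\<dots> \<le> exp (- c) * (\<Sum>k\<in>T. exp (l * f k x))"
      using k(1) T by (intro mult_left_mono member_le_sum) auto
    finally show ?thesis .
  qed
  hence "measure_pmf.expectation p (\<lambda>x. l * M x - c + 1) \<le>
      measure_pmf.expectation p (\<lambda>x. exp (- c) * (\<Sum>k\<in>T. exp (l * f k x)))"
    by (intro integral_mono int)
  also have "\<dots> = exp (- c) * (\<Sum>k\<in>T. measure_pmf.expectation p (\<lambda>x. exp (l * f k x)))"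
    by (simp add: Bochner_Integration.integral_sum int)
  also have "\<dots> \<le> exp (- c) * (\<Sum>k\<in>T. exp K)"
    by (intro mult_left_mono sum_mono mgf) auto
  also have "\<dots> = 1" using card by (simp add: c_def exp_minus exp_add exp_diff field_simps)
  also have "measure_pmf.expectation p (\<lambda>x. l * M x - c + 1) = l * measure_pmf.expectation p M - c + 1"
    by (simp add: int)
  finally show ?thesis using l unfolding M_def[symmetric] c_def[symmetric] by (simp add: field_simps)
qed

section \<open>The deviation of the empirical risk\<close>

lemma zero_in_lattice_ball: "(\<lambda>i\<in>{..<m}. 0) \<in> lattice_ball m"
  by (simp add: lattice_ball_def)

lemma uminus_in_lattice_ball:
  "z \<in> lattice_ball m \<Longrightarrow> (\<lambda>i\<in>{..<m}. - z i) \<in> lattice_ball m"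
  by (simp add: lattice_ball_def)

section \<open>Moment bounds for the centred noise\<close>

text \<open>The sign matches expected minus empirical risk. Taking the mean under the model itself
  makes centring immediate.\<close>

definition noise :: "nat \<Rightarrow> nat \<Rightarrow> real mat \<Rightarrow> real \<Rightarrow> (nat \<times> nat \<Rightarrow> bool \<times> bool) \<Rightarrow> nat \<times> nat \<Rightarrow> real" where
  "noise m n M \<rho> w ij =
     measure_pmf.expectation (YA_pmf m n M \<rho>) (\<lambda>v. of_bool (A_of v ij)) - of_bool (A_of w ij)"

lemma finite_set_YA_pmf [simp]: "finite (set_pmf (YA_pmf m n M \<rho>))"
  unfolding YA_pmf_def by (intro finite_set_Pi_pmf) auto

lemma integrable_YA_pmf [simp]:
  "integrable (measure_pmf (YA_pmf m n M \<rho>)) (f :: _ \<Rightarrow> real)"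
  by (rule integrable_measure_pmf_finite) simp

lemma expectation_noise [simp]:
  "measure_pmf.expectation (YA_pmf m n M \<rho>) (\<lambda>w. noise m n M \<rho> w ij) = 0"
  by (simp add: noise_def)

text \<open>Only the summand at \<open>kl\<close> changes; there the means cancel and the two
  indicators differ by at most 1.\<close>

lemma noise_sum_update:
  assumes I: "finite I" "kl \<in> I" and c: "\<bar>c kl\<bar> \<le> b"
  shows "(\<Sum>ij\<in>I. c ij * noise m n M \<rho> (w(kl := x)) ij) - (\<Sum>ij\<in>I. c ij * noise m n M \<rho> (w(kl := y)) ij) \<le> b"
proof -
  have "(\<Sum>ij\<in>I. c ij * noise m n M \<rho> (w(kl := x)) ij) - (\<Sum>ij\<in>I. c ij * noise m n M \<rho> (w(kl := y)) ij) =
      (\<Sum>ij\<in>I. if kl = ij then c ij * (of_bool (snd y) - of_bool (snd x)) else 0)"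
    unfolding sum_subtractf[symmetric]
    by (intro sum.cong refl) (auto simp: noise_def A_of_def algebra_simps)
  also have "\<dots> = c kl * (of_bool (snd y) - of_bool (snd x))" using I by simp
  also have "\<dots> \<le> \<bar>c kl\<bar>" by (auto simp: of_bool_def)
  finally show ?thesis using c by linarith
qed

text \<open>Sub-Gaussian bound: the linear form has mean zero, and its bounded difference at
  \<open>ij\<close> is \<open>\<bar>c ij\<bar>\<close>.\<close>

lemma noise_mgf:
  assumes l: "l > 0"
  shows "measure_pmf.expectation (YA_pmf m n M \<rho>)
      (\<lambda>w. exp (l * (\<Sum>ij\<in>{..<m} \<times> {..<n}. c ij * noise m n M \<rho> w ij)))
    \<le> exp (l\<^sup>2 * (\<Sum>ij\<in>{..<m} \<times> {..<n}. (c ij)\<^sup>2) / 8)"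
proof -
  let ?f = "\<lambda>w. \<Sum>ij\<in>{..<m} \<times> {..<n}. c ij * noise m n M \<rho> w ij"
  have "measure_pmf.expectation (YA_pmf m n M \<rho>) (\<lambda>w. exp (l * ?f w)) \<le>
      exp (l * measure_pmf.expectation (YA_pmf m n M \<rho>) ?f + l\<^sup>2 * (\<Sum>ij\<in>{..<m} \<times> {..<n}. \<bar>c ij\<bar>\<^sup>2) / 8)"
    unfolding YA_pmf_def[of m n M \<rho>]
    by (rule McDiarmid_mgf[OF _ _ l]) (auto intro!: noise_sum_update)
  thus ?thesis by (simp add: Bochner_Integration.integral_sum)
qed

text \<open>The absolute value is a maximum of two signed sums. The parameter \<open>2 / r\<close>
  makes both moment exponents \<open>1 / 2\<close>, and \<open>(ln 2 + 1 / 2) / 2\<close> is below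
  1.\<close>

lemma expectation_abs_noise_sum:
  assumes mn: "0 < m" "0 < n"
  shows "measure_pmf.expectation (YA_pmf m n M \<rho>) (\<lambda>w. \<bar>\<Sum>ij\<in>{..<m} \<times> {..<n}. noise m n M \<rho> w ij\<bar>)
    \<le> sqrt (real m * real n)"
proof -
  define r where "r = sqrt (real m * real n)"
  have r: "r > 0" "r\<^sup>2 = real m * real n" using mn by (auto simp: r_def)
  define S where "S w = (\<Sum>ij\<in>{..<m} \<times> {..<n}. noise m n M \<rho> w ij)" for w
  have "measure_pmf.expectation (YA_pmf m n M \<rho>) (\<lambda>w. Max ((\<lambda>k. k * S w) ` {1, -1 :: real}))
      \<le> (ln (real (card {1, -1 :: real})) + 1 / 2) / (2 / r)"
  proof (rule expectation_Max_le)
    fix k :: real assume k: "k \<in> {1, -1}"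
    have "measure_pmf.expectation (YA_pmf m n M \<rho>) (\<lambda>w. exp (2 / r * (k * S w)))
        \<le> exp ((2 / r)\<^sup>2 * (\<Sum>ij\<in>{..<m} \<times> {..<n}. k\<^sup>2) / 8)"
      using noise_mgf[of "2 / r" m n M \<rho> "\<lambda>_. k"] r by (simp add: S_def sum_distrib_left)
    also have "(2 / r)\<^sup>2 * (\<Sum>ij\<in>{..<m} \<times> {..<n}. k\<^sup>2) / 8 = 1 / 2"
      using k r mn by (auto simp: power_divide)
    finally show "measure_pmf.expectation (YA_pmf m n M \<rho>) (\<lambda>w. exp (2 / r * (k * S w))) \<le> exp (1 / 2)" .
  qed (use r in auto)
  also have "(\<lambda>w. Max ((\<lambda>k. k * S w) ` {1, -1 :: real})) = (\<lambda>w. \<bar>S w\<bar>)"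
    by (auto simp: max_def)
  also have "(ln (real (card {1, -1 :: real})) + 1 / 2) / (2 / r) \<le> r"
    using r ln_le_minus_one[of "2 :: real"] by (simp add: field_simps)
  finally show ?thesis by (simp add: S_def r_def)
qed

text \<open>A discrete stand-in for the operator norm of the noise: by rounding it dominates the
  bilinear form on the unit balls, and as a finite maximum it has a mean controlled by moment
  generating functions.\<close>

definition lattice_norm :: "nat \<Rightarrow> nat \<Rightarrow> real mat \<Rightarrow> real \<Rightarrow> (nat \<times> nat \<Rightarrow> bool \<times> bool) \<Rightarrow> real" where
  "lattice_norm m n M \<rho> w = Max ((\<lambda>zw. \<Sum>ij\<in>{..<m} \<times> {..<n}.
     real_of_int (fst zw (fst ij)) * real_of_int (snd zw (snd ij)) / sqrt (real m * real n) *
     noise m n M \<rho> w ij) ` (lattice_ball m \<times> lattice_ball n))"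

lemma expectation_lattice_norm:
  assumes mn: "0 < m" "0 < n"
  shows "measure_pmf.expectation (YA_pmf m n M \<rho>) (lattice_norm m n M \<rho>) \<le>
    (ln 48 + 2) * sqrt (real m + real n)"
proof -
  define T where "T = lattice_ball m \<times> lattice_ball n"
  \<comment> \<open>This \<open>l\<close> balances the two contributions: the log-cardinality is at
    most \<open>ln 48 * l\<^sup>2\<close> and the moment exponent at most
    \<open>2 * l\<^sup>2\<close>.\<close>
  define l where "l = sqrt (real m + real n)"
  have l: "l > 0" "l\<^sup>2 = real m + real n" using mn by (auto simp: l_def)
  have T: "finite T" "T \<noteq> {}" using zero_in_lattice_ball by (auto simp: T_def)
  have "measure_pmf.expectation (YA_pmf m n M \<rho>) (lattice_norm m n M \<rho>) \<le> (ln (real (card T)) + 2 * l\<^sup>2) / l"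
    unfolding lattice_norm_def T_def[symmetric]
  proof (rule expectation_Max_le)
    fix zw assume "zw \<in> T"
    then obtain z w where zw: "zw = (z, w)" "z \<in> lattice_ball m" "w \<in> lattice_ball n"
      by (auto simp: T_def)
    let ?c = "\<lambda>ij. real_of_int (fst zw (fst ij)) * real_of_int (snd zw (snd ij)) / sqrt (real m * real n)"
    \<comment> \<open>The coefficients have product form, so their squares factor into two sums, at
      most \<open>4 * m\<close> and \<open>4 * n\<close>; hence the 16.\<close>
    have "(\<Sum>ij\<in>{..<m} \<times> {..<n}. (?c ij)\<^sup>2) =
        (\<Sum>i<m. (real_of_int (z i))\<^sup>2) * (\<Sum>j<n. (real_of_int (w j))\<^sup>2) / (real m * real n)"
      by (simp add: zw(1) sum.cartesian_product' power_divide power_mult_distrib sum_product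
          sum_divide_distrib case_prod_unfold)
    also have "(\<Sum>i<m. (real_of_int (z i))\<^sup>2) = real_of_int (\<Sum>i<m. (z i)\<^sup>2)" by simp
    also have "(\<Sum>j<n. (real_of_int (w j))\<^sup>2) = real_of_int (\<Sum>j<n. (w j)\<^sup>2)" by simp
    also have "real_of_int (\<Sum>i<m. (z i)\<^sup>2) * real_of_int (\<Sum>j<n. (w j)\<^sup>2) / (real m * real n) \<le>
        real_of_int (4 * int m) * real_of_int (4 * int n) / (real m * real n)"
      using zw(2,3) unfolding lattice_ball_def
      by (intro divide_right_mono mult_mono) (auto simp del: of_int_sum of_int_mult intro!: sum_nonneg)
    also have "\<dots> = 16" using mn by simp
    finally have c: "(\<Sum>ij\<in>{..<m} \<times> {..<n}. (?c ij)\<^sup>2) \<le> 16" .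
    have "measure_pmf.expectation (YA_pmf m n M \<rho>)
        (\<lambda>w. exp (l * (\<Sum>ij\<in>{..<m} \<times> {..<n}. ?c ij * noise m n M \<rho> w ij)))
      \<le> exp (l\<^sup>2 * (\<Sum>ij\<in>{..<m} \<times> {..<n}. (?c ij)\<^sup>2) / 8)"
      by (rule noise_mgf[OF l(1)])
    also have "\<dots> \<le> exp (2 * l\<^sup>2)"
      using mult_left_mono[OF c, of "l\<^sup>2"] by simp
    finally show "measure_pmf.expectation (YA_pmf m n M \<rho>)
        (\<lambda>w. exp (l * (\<Sum>ij\<in>{..<m} \<times> {..<n}. ?c ij * noise m n M \<rho> w ij))) \<le> exp (2 * l\<^sup>2)" .
  qed (use T l in auto)
  also have "\<dots> \<le> (ln 48 * l\<^sup>2 + 2 * l\<^sup>2) / l"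
  proof -
    have "real (card T) \<le> 48 ^ m * 48 ^ n"
      unfolding T_def card_cartesian_product of_nat_mult
      by (intro mult_mono card_lattice_ball) auto
    hence "ln (real (card T)) \<le> ln (48 ^ (m + n))"
      using T by (subst ln_le_cancel_iff) (auto simp: power_add card_gt_0_iff)
    also have "\<dots> = ln 48 * l\<^sup>2" by (simp add: ln_realpow l(2))
    finally show ?thesis using l by (intro divide_right_mono) auto
  qed
  also have "\<dots> = (ln 48 + 2) * l" using l(1) by (simp add: field_simps power2_eq_square)
  finally show ?thesis by (simp add: l_def)
qed

lemma lattice_norm_ge:
  assumes "z \<in> lattice_ball m" "w \<in> lattice_ball n"
  shows "(\<Sum>i<m. \<Sum>j<n. real_of_int (z i) * noise m n M \<rho> v (i, j) * real_of_int (w j)) / sqrt (real m * real n)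
    \<le> lattice_norm m n M \<rho> v"
proof -
  have "(\<Sum>i<m. \<Sum>j<n. real_of_int (z i) * noise m n M \<rho> v (i, j) * real_of_int (w j)) / sqrt (real m * real n) =
      (\<Sum>ij\<in>{..<m} \<times> {..<n}. real_of_int (fst (z, w) (fst ij)) * real_of_int (snd (z, w) (snd ij)) /
        sqrt (real m * real n) * noise m n M \<rho> v ij)"
    by (simp add: sum.cartesian_product' case_prod_unfold sum_divide_distrib mult_ac)
  also have "\<dots> \<le> lattice_norm m n M \<rho> v"
    unfolding lattice_norm_def
    by (intro Max_ge image_eqI[where x = "(z, w)"]) (use assms in auto)
  finally show ?thesis .
qed

lemma lattice_norm_nonneg: "0 \<le> lattice_norm m n M \<rho> v"
  using lattice_norm_ge[OF zero_in_lattice_ball zero_in_lattice_ball, of m n M \<rho> v] by simp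

text \<open>Nuclear norm duality, with \<open>lattice_norm\<close> bounding the operator norm.
  Negating \<open>z\<close> stays in the ball, so the same maximum also bounds the negated
  noise.\<close>

lemma noise_nuclear_norm_bound:
  assumes mn: "0 < m" "0 < n" and X: "X \<in> carrier_mat m n"
  shows "\<bar>\<Sum>ij\<in>{..<m} \<times> {..<n}. X $$ ij * noise m n M \<rho> w ij\<bar> \<le> lattice_norm m n M \<rho> w * nuclear_norm X"
proof -
  let ?N = "lattice_norm m n M \<rho> w"
  let ?W = "\<lambda>i j. noise m n M \<rho> w (i, j)"
  have "(\<Sum>i<m. \<Sum>j<n. ?W i j * X $$ (i, j)) \<le> ?N * nuclear_norm X"
    using mn by (intro nuclear_norm_duality[OF X] bilinear_form_le_lattice_bound lattice_norm_ge)
  moreover have "(\<Sum>i<m. \<Sum>j<n. - ?W i j * X $$ (i, j)) \<le> ?N * nuclear_norm X"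
  proof (intro nuclear_norm_duality[OF X] bilinear_form_le_lattice_bound mn)
    fix z v assume zv: "z \<in> lattice_ball m" "v \<in> lattice_ball n"
    show "(\<Sum>i<m. \<Sum>j<n. real_of_int (z i) * - ?W i j * real_of_int (v j)) / sqrt (real m * real n) \<le> ?N"
      using lattice_norm_ge[OF uminus_in_lattice_ball[OF zv(1)] zv(2), of M \<rho> w] by simp
  qed
  moreover have "(\<Sum>ij\<in>{..<m} \<times> {..<n}. X $$ ij * noise m n M \<rho> w ij) = (\<Sum>i<m. \<Sum>j<n. ?W i j * X $$ (i, j))"
    by (simp add: sum.cartesian_product' case_prod_unfold mult.commute)
  ultimately show ?thesis by (simp add: sum_negf abs_le_iff)
qed

section \<open>The risk gap as a linear form, and its supremum\<close>

definition deviation :: "nat \<Rightarrow> nat \<Rightarrow> real mat \<Rightarrow> real \<Rightarrow> real mat \<Rightarrow> (nat \<times> nat \<Rightarrow> bool \<times> bool) \<Rightarrow> real" where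
  "deviation m n M \<rho> X w = (\<Sum>ij\<in>{..<m} \<times> {..<n}. (1 - 2 * X $$ ij) * noise m n M \<rho> w ij)"

text \<open>The loss is \<open>x\<^sup>2\<close> plus \<open>(1 - 2 * x) / (1 - \<rho>)\<close>
  times the indicator of an observed one. The quadratic part is deterministic and cancels.\<close>

lemma risk_gap_eq_deviation:
  assumes X: "X \<in> carrier_mat m n" and \<rho>: "\<rho> < 1"
  shows "exp_risk m n M \<rho> X - emp_risk \<rho> X (A_of w) = deviation m n M \<rho> X w / ((1 - \<rho>) * real m * real n)"
proof -
  let ?E = "measure_pmf.expectation (YA_pmf m n M \<rho>)"
  have loss: "loss_tilde \<rho> x a = x\<^sup>2 + (1 - 2 * x) / (1 - \<rho>) * of_bool a" for x a
    using \<rho> by (simp add: loss_tilde_def field_simps power2_eq_square)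
  have emp: "emp_risk \<rho> X (A_of v) = (1 / (real m * real n)) *
      (\<Sum>ij\<in>{..<m} \<times> {..<n}. (X $$ ij)\<^sup>2 + (1 - 2 * X $$ ij) / (1 - \<rho>) * of_bool (A_of v ij))" for v
    using X by (simp add: emp_risk_def loss sum.cartesian_product' case_prod_unfold)
  have "exp_risk m n M \<rho> X = (1 / (real m * real n)) *
      (\<Sum>ij\<in>{..<m} \<times> {..<n}. (X $$ ij)\<^sup>2 + (1 - 2 * X $$ ij) / (1 - \<rho>) * ?E (\<lambda>v. of_bool (A_of v ij)))"
    unfolding exp_risk_def emp by (simp add: Bochner_Integration.integral_sum)
  hence "exp_risk m n M \<rho> X - emp_risk \<rho> X (A_of w) = (1 / (real m * real n)) *
      (\<Sum>ij\<in>{..<m} \<times> {..<n}. (1 - 2 * X $$ ij) / (1 - \<rho>) * noise m n M \<rho> w ij)"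
    unfolding emp noise_def
    by (simp only: right_diff_distrib[symmetric] sum_subtractf[symmetric] add_diff_add diff_self add_0)
  also have "\<dots> = (1 / (real m * real n)) * (deviation m n M \<rho> X w / (1 - \<rho>))"
    by (simp add: deviation_def sum_divide_distrib)
  finally show ?thesis by (simp add: mult_ac)
qed

text \<open>The coefficients 1 and \<open>- 2 * X\<close> are treated separately: the first gives a
  plain noise sum, and duality is applied to \<open>X\<close> alone, whose nuclear norm is at most
  \<open>t\<close>.\<close>

lemma abs_deviation_le:
  assumes mn: "0 < m" "0 < n" and X: "X \<in> feasible_set m n t"
  shows "\<bar>deviation m n M \<rho> X w\<bar> \<le>
    \<bar>\<Sum>ij\<in>{..<m} \<times> {..<n}. noise m n M \<rho> w ij\<bar> + 2 * t * lattice_norm m n M \<rho> w"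
proof -
  have Xc: "X \<in> carrier_mat m n" and nn: "nuclear_norm X \<le> t" using X by (auto simp: feasible_set_def)
  have "deviation m n M \<rho> X w = (\<Sum>ij\<in>{..<m} \<times> {..<n}. noise m n M \<rho> w ij) -
      2 * (\<Sum>ij\<in>{..<m} \<times> {..<n}. X $$ ij * noise m n M \<rho> w ij)"
    by (simp add: deviation_def left_diff_distrib sum_subtractf sum_distrib_left mult.assoc)
  moreover have "\<bar>\<Sum>ij\<in>{..<m} \<times> {..<n}. X $$ ij * noise m n M \<rho> w ij\<bar> \<le> lattice_norm m n M \<rho> w * t"
    using noise_nuclear_norm_bound[OF mn Xc, of M \<rho> w] mult_left_mono[OF nn lattice_norm_nonneg]
    by (rule order_trans)
  ultimately show ?thesis by (simp add: mult.commute)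
qed

lemma zero_in_feasible_set: "0 \<le> t \<Longrightarrow> 0\<^sub>m m n \<in> feasible_set m n t"
  by (simp add: feasible_set_def)

definition sup_deviation :: "nat \<Rightarrow> nat \<Rightarrow> real mat \<Rightarrow> real \<Rightarrow> real \<Rightarrow> (nat \<times> nat \<Rightarrow> bool \<times> bool) \<Rightarrow> real" where
  "sup_deviation m n M \<rho> t w = (SUP X\<in>feasible_set m n t. \<bar>deviation m n M \<rho> X w\<bar>)"

text \<open>The real-valued supremum needs boundedness, which \<open>abs_deviation_le\<close>
  provides uniformly in \<open>X\<close>.\<close>

lemma abs_deviation_le_sup:
  assumes "0 < m" "0 < n" "X \<in> feasible_set m n t"
  shows "\<bar>deviation m n M \<rho> X w\<bar> \<le> sup_deviation m n M \<rho> t w"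
  unfolding sup_deviation_def
  by (rule cSUP_upper[OF assms(3)]) (auto intro!: bdd_aboveI2 abs_deviation_le assms)

text \<open>Entries of \<open>X\<close> in \<open>[0, 1]\<close> give
  \<open>\<bar>1 - 2 * X\<bar> \<le> 1\<close>, so each deviation moves by at most 1 and the
  supremum inherits this.\<close>

lemma sup_deviation_update:
  assumes mn: "0 < m" "0 < n" and t: "0 \<le> t" and kl: "kl \<in> {..<m} \<times> {..<n}"
  shows "sup_deviation m n M \<rho> t (w(kl := x)) - sup_deviation m n M \<rho> t (w(kl := y)) \<le> 1"
proof -
  have "\<bar>deviation m n M \<rho> X (w(kl := x))\<bar> \<le> sup_deviation m n M \<rho> t (w(kl := y)) + 1"
    if X: "X \<in> feasible_set m n t" for X
  proof -
    have "0 \<le> X $$ kl \<and> X $$ kl \<le> 1" using X kl by (cases kl) (auto simp: feasible_set_def)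
    hence c: "\<bar>1 - 2 * X $$ kl\<bar> \<le> 1" by linarith
    have "deviation m n M \<rho> X (w(kl := a)) - deviation m n M \<rho> X (w(kl := b)) \<le> 1" for a b
      unfolding deviation_def by (rule noise_sum_update) (use kl c in auto)
    \<comment> \<open>The two orders of \<open>x\<close> and \<open>y\<close> together control the
      change of the absolute value.\<close>
    from this[of x y] this[of y x] abs_deviation_le_sup[OF mn X, of M \<rho> "w(kl := y)"]
    show ?thesis by linarith
  qed
  hence "sup_deviation m n M \<rho> t (w(kl := x)) \<le> sup_deviation m n M \<rho> t (w(kl := y)) + 1"
    unfolding sup_deviation_def[of m n M \<rho> t "w(kl := x)"]
    using zero_in_feasible_set[OF t] by (intro cSUP_least) auto
  thus ?thesis by simp
qed

lemma expectation_sup_deviation: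
  assumes mn: "0 < m" "0 < n" and t: "0 \<le> t"
  shows "measure_pmf.expectation (YA_pmf m n M \<rho>) (sup_deviation m n M \<rho> t) \<le>
    sqrt (real m * real n) + 2 * t * ((ln 48 + 2) * sqrt (real m + real n))"
proof -
  let ?E = "measure_pmf.expectation (YA_pmf m n M \<rho>)"
  let ?S = "\<lambda>w. \<bar>\<Sum>ij\<in>{..<m} \<times> {..<n}. noise m n M \<rho> w ij\<bar>"
  have "sup_deviation m n M \<rho> t w \<le> ?S w + 2 * t * lattice_norm m n M \<rho> w" for w
    unfolding sup_deviation_def
    using zero_in_feasible_set[OF t] by (intro cSUP_least abs_deviation_le mn) auto
  hence "?E (sup_deviation m n M \<rho> t) \<le> ?E (\<lambda>w. ?S w + 2 * t * lattice_norm m n M \<rho> w)"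
    by (intro integral_mono) auto
  also have "\<dots> = ?E ?S + 2 * t * ?E (lattice_norm m n M \<rho>)" by simp
  also have "\<dots> \<le> sqrt (real m * real n) + 2 * t * ((ln 48 + 2) * sqrt (real m + real n))"
    using t by (intro add_mono mult_left_mono expectation_abs_noise_sum expectation_lattice_norm mn) auto
  finally show ?thesis .
qed

text \<open>McDiarmid's inequality with all differences 1, whose squares sum to
  \<open>m * n\<close>. The last summand is the excess over the mean at which the tail bound equals
  \<delta>.\<close>

lemma prob_sup_deviation:
  assumes mn: "0 < m" "0 < n" and t: "0 \<le> t" and \<delta>: "0 < \<delta>" "\<delta> < 1"
  shows "measure_pmf.prob (YA_pmf m n M \<rho>)
    {w. sup_deviation m n M \<rho> t w < sqrt (real m * real n) + 2 * t * ((ln 48 + 2) * sqrt (real m + real n)) +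
      sqrt (real m * real n * ln (1 / \<delta>) / 2)} \<ge> 1 - \<delta>" (is "measure_pmf.prob ?P {w. ?F w < ?B + ?s} \<ge> _")
proof -
  have s: "?s > 0" using mn \<delta> by simp
  have card: "(\<Sum>ij\<in>{..<m} \<times> {..<n}. 1\<^sup>2) = real m * real n" by simp
  have "measure_pmf.prob ?P {w. ?F w \<ge> measure_pmf.expectation ?P ?F + ?s} \<le>
      exp (- 2 * ?s\<^sup>2 / (\<Sum>ij\<in>{..<m} \<times> {..<n}. 1\<^sup>2))"
    unfolding YA_pmf_def
    by (rule McDiarmid_tail) (use s mn t in \<open>auto intro!: sup_deviation_update\<close>)
  also have "\<dots> = \<delta>"
  proof -
    have "?s\<^sup>2 = real m * real n * ln (1 / \<delta>) / 2" using s by (intro real_sqrt_pow2) simp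
    thus ?thesis unfolding card using mn \<delta> by (simp add: ln_div)
  qed
  finally have "1 - \<delta> \<le> 1 - measure_pmf.prob ?P {w. ?F w \<ge> measure_pmf.expectation ?P ?F + ?s}" by simp
  also have "\<dots> = measure_pmf.prob ?P (UNIV - {w. ?F w \<ge> measure_pmf.expectation ?P ?F + ?s})"
    using measure_pmf.prob_compl[of "{w. ?F w \<ge> measure_pmf.expectation ?P ?F + ?s}" ?P] by simp
  \<comment> \<open>Replacing the mean by its upper bound enlarges the event.\<close>
  also have "\<dots> \<le> measure_pmf.prob ?P {w. ?F w < ?B + ?s}"
    using expectation_sup_deviation[OF mn t, of M \<rho>]
    by (intro measure_pmf.finite_measure_mono) auto
  finally show ?thesis .
qed

section \<open>Comparison of the concentration bound with the stated rate\<close>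

text \<open>The inequality holds at every outcome in the event of \<open>prob_sup_deviation\<close>:
  the operator norm part goes into the first term, and the mean of the plain noise sum joins the
  tail in the second.\<close>

theorem theorem3:
  "\<exists>C::real. \<forall>(m::nat) (n::nat) (M::real mat) (\<rho>::real) (t::real) (\<delta>::real).
     0 < m \<longrightarrow> 0 < n \<longrightarrow> M \<in> carrier_mat m n \<longrightarrow>
     (\<forall>i<m. \<forall>j<n. 0 \<le> M $$ (i, j) \<and> M $$ (i, j) \<le> 1) \<longrightarrow>
     0 \<le> \<rho> \<longrightarrow> \<rho> < 1 \<longrightarrow> 0 < t \<longrightarrow> 0 < \<delta> \<longrightarrow> \<delta> < 1 \<longrightarrow>
     measure_pmf.prob (YA_pmf m n M \<rho>)
       {\<omega>. (SUP X\<in>feasible_set m n t. \<bar>exp_risk m n M \<rho> X - emp_risk \<rho> X (A_of \<omega>)\<bar>)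
            \<le> t * C * (sqrt (real n) + sqrt (real m) + root 4 (real (num_ones m n (Y_of \<omega>))))
                 / ((1 - \<rho>) * real m * real n)
               + 3 * sqrt (ln (2 / \<delta>)) / (sqrt (real m * real n) * (1 - \<rho>))}
     \<ge> 1 - \<delta>"
proof (intro exI[of _ "2 * (ln 48 + 2)"] allI impI)
  fix m n :: nat and M :: "real mat" and \<rho> t \<delta> :: real
  assume mn: "0 < m" "0 < n" and \<rho>: "\<rho> < 1" and t: "0 < t" and \<delta>: "0 < \<delta>" "\<delta> < 1"
  \<comment> \<open>The factor 2 comes from the coefficient \<open>- 2 * X\<close>, and
    \<open>ln 48 + 2\<close> from \<open>expectation_lattice_norm\<close>.\<close>
  define C :: real where "C = 2 * (ln 48 + 2)"
  define r where "r = sqrt (real m * real n)"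
  define L where "L = ln (2 / \<delta>)"
  define D where "D = (1 - \<rho>) * real m * real n"
  have C: "C \<ge> 0" by (simp add: C_def)
  have r: "r > 0" "r * r = real m * real n" using mn by (auto simp: r_def)
  have D: "D > 0" using mn \<rho> by (simp add: D_def)
  have L: "L = ln 2 + ln (1 / \<delta>)" "L \<ge> ln (1 / \<delta>)" "ln (1 / \<delta>) > 0"
    using \<delta> by (auto simp: L_def ln_div)
  \<comment> \<open>Origin of the constant 3: \<open>L \<ge> ln 2 \<ge> 2 / 3\<close> lets
    \<open>2 * sqrt L\<close> absorb the 1 from the mean, and one more \<open>sqrt L\<close> absorbs
    the tail.\<close>
  have "1 \<le> 4 * L" using L ln2_ge_two_thirds by linarith
  hence "sqrt 1 \<le> sqrt (4 * L)" by (rule real_sqrt_le_mono)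
  hence one: "1 \<le> 2 * sqrt L" by (simp add: real_sqrt_mult)
  have "sqrt (ln (1 / \<delta>) / 2) \<le> sqrt L" using L by (intro real_sqrt_le_mono) auto
  hence tail: "r + sqrt (real m * real n * ln (1 / \<delta>) / 2) \<le> r * (3 * sqrt L)"
    using mult_left_mono[of "1 + sqrt (ln (1 / \<delta>) / 2)" "3 * sqrt L" r] one r(1)
    by (simp add: r_def real_sqrt_mult real_sqrt_divide algebra_simps)
  have bound: "(SUP X\<in>feasible_set m n t. \<bar>exp_risk m n M \<rho> X - emp_risk \<rho> X (A_of w)\<bar>)
      \<le> t * C * (sqrt (real n) + sqrt (real m) + root 4 (real (num_ones m n (Y_of w)))) / D
         + 3 * sqrt L / (r * (1 - \<rho>))"
    if w: "sup_deviation m n M \<rho> t w < r + 2 * t * ((ln 48 + 2) * sqrt (real m + real n)) +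
      sqrt (real m * real n * ln (1 / \<delta>) / 2)" for w
  proof -
    let ?R = "sqrt (real n) + sqrt (real m) + root 4 (real (num_ones m n (Y_of w)))"
    \<comment> \<open>Subadditivity of the square root, together with nonnegativity of the fourth
      root.\<close>
    have "sqrt (real m + real n) \<le> ?R"
      using sqrt_add_le_add_sqrt[of "real m" "real n"] real_root_ge_zero[of "real (num_ones m n (Y_of w))" 4]
      by linarith
    hence "t * C * sqrt (real m + real n) \<le> t * C * ?R" using t C by (intro mult_left_mono) auto
    hence "sup_deviation m n M \<rho> t w \<le> t * C * ?R + r * (3 * sqrt L)"
      using w tail by (simp add: C_def algebra_simps)
    hence "sup_deviation m n M \<rho> t w / D \<le> (t * C * ?R + r * (3 * sqrt L)) / D"
      using D by (intro divide_right_mono) auto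
    also have "\<dots> = t * C * ?R / D + 3 * sqrt L / (r * (1 - \<rho>))"
    proof -
      \<comment> \<open>One factor \<open>r\<close> cancels, turning division by
        \<open>m * n\<close> into division by its square root.\<close>
      have "D = r * r * (1 - \<rho>)" by (simp add: D_def r(2))
      thus ?thesis using r(1) \<rho> by (simp add: add_divide_distrib)
    qed
    finally have le: "sup_deviation m n M \<rho> t w / D \<le> t * C * ?R / D + 3 * sqrt L / (r * (1 - \<rho>))" .
    show ?thesis
    proof (rule cSUP_least)
      show "feasible_set m n t \<noteq> {}" using zero_in_feasible_set t by (metis empty_iff less_imp_le)
      fix X assume X: "X \<in> feasible_set m n t"
      hence "X \<in> carrier_mat m n" by (simp add: feasible_set_def)
      hence "\<bar>exp_risk m n M \<rho> X - emp_risk \<rho> X (A_of w)\<bar> = \<bar>deviation m n M \<rho> X w\<bar> / D"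
        using D \<rho> by (simp add: risk_gap_eq_deviation D_def[symmetric])
      also have "\<dots> \<le> sup_deviation m n M \<rho> t w / D"
        using D by (intro divide_right_mono abs_deviation_le_sup mn X) auto
      finally show "\<bar>exp_risk m n M \<rho> X - emp_risk \<rho> X (A_of w)\<bar> \<le>
          t * C * ?R / D + 3 * sqrt L / (r * (1 - \<rho>))" using le by simp
    qed
  qed
  have "1 - \<delta> \<le> measure_pmf.prob (YA_pmf m n M \<rho>)
    {w. sup_deviation m n M \<rho> t w < r + 2 * t * ((ln 48 + 2) * sqrt (real m + real n)) +
      sqrt (real m * real n * ln (1 / \<delta>) / 2)}"
    unfolding r_def using t by (intro prob_sup_deviation mn \<delta>) auto
  also have "\<dots> \<le> measure_pmf.prob (YA_pmf m n M \<rho>)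
    {\<omega>. (SUP X\<in>feasible_set m n t. \<bar>exp_risk m n M \<rho> X - emp_risk \<rho> X (A_of \<omega>)\<bar>)
      \<le> t * C * (sqrt (real n) + sqrt (real m) + root 4 (real (num_ones m n (Y_of \<omega>)))) / D
         + 3 * sqrt L / (r * (1 - \<rho>))}"
    by (intro measure_pmf.finite_measure_mono) (auto intro: bound)
  finally show "1 - \<delta> \<le> measure_pmf.prob (YA_pmf m n M \<rho>)
       {\<omega>. (SUP X\<in>feasible_set m n t. \<bar>exp_risk m n M \<rho> X - emp_risk \<rho> X (A_of \<omega>)\<bar>)
            \<le> t * (2 * (ln 48 + 2)) * (sqrt (real n) + sqrt (real m) + root 4 (real (num_ones m n (Y_of \<omega>))))
                 / ((1 - \<rho>) * real m * real n)
               + 3 * sqrt (ln (2 / \<delta>)) / (sqrt (real m * real n) * (1 - \<rho>))}"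
    unfolding C_def D_def L_def r_def .
qed

end
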